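(* Let $r\ge 13$ be an integer. Then: (a) $F_v(2_r;r-10)\ge r+21$; moreover, if $R(10,3)>41$ and $r\ge 20$, then $F_v(2_r;r-10)=r+21$; (b) if $R(10,3)\le 41$, then $F_v(2_r;r-10)\ge r+22$, and $F_v(2_r;r-10)=r+22$ whenever $r\ge 21$.
   Context: All graphs are finite, simple and undirected. $\mathrm{cl}(G)$ is the clique number of $G$. $G\overset{v}{\to}(a_1,\dots,a_r)$ means: for every partition $V(G)=V_1\cup\dots\cup V_r$ into pairwise disjoint sets, some $V_i$ contains an $a_i$-clique. $H_v(a_1,\dots,a_r;q)$ is the set of graphs $G$ with $G\overset{v}{\to}(a_1,\dots,a_r)$ and $\mathrm{cl}(G)<q$, and $F_v(a_1,\dots,a_r;q)=\min\{|V(G)|:G\in H_v(a_1,\dots,a_r;q)\}$. $F_v(2_r;q)$ denotes $F_v(2,\dots,2;q)$ with $r$ twos. The Ramsey number $R(p,q)$ is the least $n$ such that every graph on at least $n$ vertices has a $p$-clique or an independent set of size $q$. *)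

theory Defs
  imports Main "HOL-Library.Extended_Nat"
begin

definition graph :: "'a set \<Rightarrow> 'a set set \<Rightarrow> bool" where
  "graph V E \<longleftrightarrow> finite V \<and> (\<forall>e\<in>E. e \<subseteq> V \<and> card e = 2)"

definition clique :: "'a set \<Rightarrow> 'a set set \<Rightarrow> 'a set \<Rightarrow> bool" where
  "clique V E S \<longleftrightarrow> S \<subseteq> V \<and> (\<forall>x\<in>S. \<forall>y\<in>S. x \<noteq> y \<longrightarrow> {x, y} \<in> E)"

definition indep_set :: "'a set \<Rightarrow> 'a set set \<Rightarrow> 'a set \<Rightarrow> bool" where
  "indep_set V E S \<longleftrightarrow> S \<subseteq> V \<and> (\<forall>x\<in>S. \<forall>y\<in>S. x \<noteq> y \<longrightarrow> {x, y} \<notin> E)"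

definition clique_number :: "'a set \<Rightarrow> 'a set set \<Rightarrow> nat" where
  "clique_number V E = Max {card S | S. clique V E S}"

definition vertex_arrows :: "'a set \<Rightarrow> 'a set set \<Rightarrow> nat list \<Rightarrow> bool" where
  "vertex_arrows V E as \<longleftrightarrow>
     (\<forall>P :: nat \<Rightarrow> 'a set.
        (\<Union>i<length as. P i) = V \<and>
        (\<forall>i<length as. \<forall>j<length as. i \<noteq> j \<longrightarrow> P i \<inter> P j = {}) \<longrightarrow>
        (\<exists>i<length as. \<exists>S. S \<subseteq> P i \<and> clique V E S \<and> card S = as ! i))"

text \<open>H_v(as; q), with vertices drawn from nat (every finite graph has an isomorphic copy).\<close>
definition H_v :: "nat list \<Rightarrow> nat \<Rightarrow> (nat set \<times> nat set set) set" where
  "H_v as q = {(V, E). graph V E \<and> vertex_arrows V E as \<and> clique_number V E < q}"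

text \<open>F_v(as; q) = min |V(G)| over H_v(as;q); infinity if H_v(as;q) is empty.\<close>
definition F_v :: "nat list \<Rightarrow> nat \<Rightarrow> enat" where
  "F_v as q = Inf ((\<lambda>(V, E). enat (card V)) ` H_v as q)"

text \<open>Ramsey number R(p,q): least n such that every graph on at least n vertices has a
  p-clique or an independent set of size q (infinity if no such n).\<close>
definition ramsey_number :: "nat \<Rightarrow> nat \<Rightarrow> enat" where
  "ramsey_number p q = Inf (enat ` {n. \<forall>(V :: nat set) E. graph V E \<and> card V \<ge> n \<longrightarrow>
      (\<exists>S. clique V E S \<and> card S = p) \<or> (\<exists>I. indep_set V E I \<and> card I = q)})"

end

theory Submission
  imports Defs "HOL-Library.Code_Binary_Nat"
begin

text \<open>
  A graph arrows \<open>(2\<^sub>r)\<close> iff its chromatic number exceeds \<open>r\<close>, so the question is how few vertices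
  a graph with \<open>\<chi> - \<omega> \<ge> 12\<close> can have. Put \<open>c = |V| - \<chi>\<close>. Removing an independent triple lowers
  \<open>c\<close> by at least two and \<open>\<chi> - \<omega>\<close> by at most one. Without such triples the complement \<open>H\<close> is
  triangle-free and \<open>c\<close> is the matching number \<open>\<nu>\<close> of \<open>H\<close>; by Gallai's lemma \<open>H\<close> reduces to
  pieces with \<open>2 \<nu> + 1\<close> vertices, in which the bounds for \<open>R(3, k)\<close> give large independent sets. The
  critical ones are \<open>R(3, 9) \<le> 37\<close>, obtained by a Graver-Yackel count of edges, and the hypothesis on
  \<open>R(3, 10)\<close>. For the upper bounds, join a complete graph to a graph without independent triples:
  one on 41 vertices without 10-cliques, given by \<open>R(10, 3) > 41\<close>, or the complement of the
  circulant graph on \<open>\<int>/43\<close> with connection set \<open>{\<plusminus>1, \<plusminus>4, \<plusminus>6, \<plusminus>9, \<plusminus>20}\<close>, which has no 11-clique.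
\<close>

section \<open>Edge counts in triangle-free graphs\<close>

locale triangle_free =
  fixes E :: "'a set set"
  assumes edge_card: "e \<in> E \<Longrightarrow> card e = 2"
    and no_triangle: "{x, y} \<in> E \<Longrightarrow> {y, z} \<in> E \<Longrightarrow> {x, z} \<notin> E"
begin

definition nbh :: "'a set \<Rightarrow> 'a \<Rightarrow> 'a set" where
  "nbh W v = {u \<in> W. {v, u} \<in> E}"

text \<open>Twice the number of edges induced on \<open>W\<close>. The doubled count avoids edge
  sets; its parity is supplied by \<open>even_degsum\<close>.\<close>

definition degsum :: "'a set \<Rightarrow> nat" where
  "degsum W = (\<Sum>v\<in>W. card (nbh W v))"

lemma no_loop: "{x} \<notin> E"
  using edge_card[of "{x}"] by auto

lemma finite_nbh [simp]: "finite W \<Longrightarrow> finite (nbh W v)"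
  by (simp add: nbh_def)

lemma nbh_subset: "nbh W v \<subseteq> W"
  by (auto simp: nbh_def)

lemma indep_nbh: "indep_set W E (nbh W v)"
  unfolding indep_set_def nbh_def using no_triangle by (auto simp: insert_commute)

text \<open>The neighbourhood of \<open>v\<close> is independent, so every edge either meets it in
  exactly one end or avoids it, and the edges avoiding it also avoid \<open>v\<close>.\<close>

lemma degsum_remove_nbh:
  assumes "finite W" "v \<in> W"
  shows "degsum W = degsum (W - insert v (nbh W v)) + 2 * (\<Sum>u\<in>nbh W v. card (nbh W u))"
proof -
  define a :: "'a \<Rightarrow> 'a \<Rightarrow> nat" where "a x y = (if {x, y} \<in> E then 1 else 0)" for x y
  have card_nbh: "card (nbh X x) = (\<Sum>y\<in>X. a x y)" if "finite X" for X x
    using that by (simp add: nbh_def a_def sum.If_cases Int_def)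
  have a_sym: "a x y = a y x" for x y
    by (simp add: a_def insert_commute)
  define N where "N = nbh W v"
  define R where "R = W - N"
  have N: "N \<subseteq> W" and fin: "finite N" "finite R" and vR: "v \<in> R"
    using assms no_loop by (auto simp: N_def R_def nbh_def)
  have split: "(\<Sum>x\<in>W. f x) = (\<Sum>x\<in>R. f x) + (\<Sum>x\<in>N. f x)" for f :: "'a \<Rightarrow> nat"
    unfolding R_def using N assms(1) by (simp add: sum.subset_diff)
  have NN: "a x y = 0" if "x \<in> N" "y \<in> N" for x y
    using that indep_nbh[of W v] no_loop unfolding N_def indep_set_def a_def by (cases "x = y") auto
  have av: "a v y = 0" if "y \<in> R" for y
    using that by (auto simp: R_def N_def nbh_def a_def)
  have NR: "(\<Sum>u\<in>N. card (nbh W u)) = (\<Sum>x\<in>N. \<Sum>y\<in>R. a x y)"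
    using assms(1) by (simp add: card_nbh split NN)
  have "degsum W = (\<Sum>x\<in>W. \<Sum>y\<in>W. a x y)"
    using assms(1) by (simp add: degsum_def card_nbh)
  also have "\<dots> = (\<Sum>x\<in>R. \<Sum>y\<in>R. a x y) + (\<Sum>x\<in>R. \<Sum>y\<in>N. a x y) + (\<Sum>x\<in>N. \<Sum>y\<in>R. a x y)"
    by (simp add: split NN sum.distrib)
  also have "(\<Sum>x\<in>R. \<Sum>y\<in>N. a x y) = (\<Sum>x\<in>N. \<Sum>y\<in>R. a x y)"
    by (subst sum.swap) (simp add: a_sym)
  also have "(\<Sum>x\<in>R. \<Sum>y\<in>R. a x y) = (\<Sum>x\<in>R - {v}. \<Sum>y\<in>R - {v}. a x y)"
    using fin vR av a_sym[of _ v] by (simp add: sum.remove[of R v])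
  also have "\<dots> = degsum (R - {v})"
    using fin by (simp add: degsum_def card_nbh)
  also have "R - {v} = W - insert v N"
    by (auto simp: R_def)
  finally show ?thesis
    by (simp add: NR N_def[symmetric])
qed

lemma even_degsum:
  assumes "finite W"
  shows "even (degsum W)"
  using assms
proof (induction W rule: finite_psubset_induct)
  case (psubset W)
  show ?case
  proof (cases "W = {}")
    case False
    then obtain v where "v \<in> W" by blast
    moreover have "even (degsum (W - insert v (nbh W v)))"
      using \<open>v \<in> W\<close> by (intro psubset(2)) auto
    ultimately show ?thesis
      using degsum_remove_nbh[OF psubset(1) \<open>v \<in> W\<close>] by simp
  qed (simp add: degsum_def)
qed

text \<open>The Graver-Yackel identity: in the sum of degrees over adjacent pairs, the degree of
  \<open>u\<close> appears once for each neighbour of \<open>u\<close> and so contributes its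
  square.\<close>

lemma sum_degsum_remove_nbh:
  assumes "finite W"
  shows "card W * degsum W = (\<Sum>v\<in>W. degsum (W - insert v (nbh W v)) + 2 * (card (nbh W v))\<^sup>2)"
proof -
  have "(\<Sum>v\<in>W. \<Sum>u\<in>nbh W v. card (nbh W u)) = (\<Sum>v\<in>W. \<Sum>u\<in>W. if {v, u} \<in> E then card (nbh W u) else 0)"
    using assms by (intro sum.cong[OF refl]) (auto simp: nbh_def sum.If_cases Int_def)
  also have "\<dots> = (\<Sum>u\<in>W. \<Sum>v\<in>W. if {u, v} \<in> E then card (nbh W u) else 0)"
    by (subst sum.swap) (simp add: insert_commute)
  also have "\<dots> = (\<Sum>u\<in>W. (card (nbh W u))\<^sup>2)"
    using assms by (intro sum.cong) (auto simp: nbh_def sum.If_cases Int_def power2_eq_square)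
  finally have *: "(\<Sum>v\<in>W. \<Sum>u\<in>nbh W v. card (nbh W u)) = (\<Sum>u\<in>W. (card (nbh W u))\<^sup>2)" .
  have "card W * degsum W = (\<Sum>v\<in>W. degsum W)" by simp
  also have "\<dots> = (\<Sum>v\<in>W. degsum (W - insert v (nbh W v)) + 2 * (\<Sum>u\<in>nbh W v. card (nbh W u)))"
    using degsum_remove_nbh[OF assms] by (intro sum.cong) auto
  finally show ?thesis
    by (simp add: sum.distrib * flip: sum_distrib_left)
qed

lemma card_nbh_le:
  assumes "\<And>I. indep_set W E I \<Longrightarrow> card I \<le> k"
  shows "card (nbh W v) \<le> k"
  using assms indep_nbh by blast

text \<open>\<open>v\<close> extends every independent set among its non-neighbours, so the bound
  drops by one.\<close>

lemma indep_remove_nbh: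
  assumes "finite W" "v \<in> W" "\<And>I. indep_set W E I \<Longrightarrow> card I \<le> Suc k"
    and "indep_set (W - insert v (nbh W v)) E I"
  shows "card I \<le> k"
proof -
  have "I \<subseteq> W - insert v (nbh W v)"
    using assms(4) by (simp add: indep_set_def)
  moreover from this have "finite I"
    using assms(1) by (meson finite_Diff finite_subset)
  moreover have "indep_set W E (insert v I)"
    using assms(2,4) by (auto simp: indep_set_def nbh_def insert_commute)
  ultimately show ?thesis
    using assms(3)[of "insert v I"] by (auto simp: card_insert_if split: if_splits)
qed

text \<open>Weak duality: \<open>cert\<close> bounds the contribution of each vertex to the
  Graver-Yackel identity from below by a linear function of its degree, and the degrees sum to
  \<open>degsum W\<close>. Integrality enters through the rounding in \<open>a\<close> and through
  \<open>even_degsum\<close>.\<close>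

lemma degsum_bound:
  fixes e :: "nat \<Rightarrow> nat"
  assumes fin: "finite W" and n: "card W = n" and \<alpha>: "\<And>I. indep_set W E I \<Longrightarrow> card I \<le> Suc k"
    and IH: "\<And>U. U \<subset> W \<Longrightarrow> (\<And>I. indep_set U E I \<Longrightarrow> card I \<le> k) \<Longrightarrow>
               card U < l \<and> 2 * e (card U) \<le> degsum U"
    and cert: "\<And>d. d \<le> Suc k \<Longrightarrow> d < n \<Longrightarrow> n - 1 - d < l \<Longrightarrow> (n - 2 * q) * (T - 1) div n + 1 + q * d \<le> d\<^sup>2 + e (n - 1 - d)"
    and q: "2 * q < n" and T: "0 < T"
  shows "2 * T \<le> degsum W"
proof -
  \<comment> \<open>The least integer with \<open>n * a > (n - 2 * q) * (T - 1)\<close>.\<close>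
  define a where "a = (n - 2 * q) * (T - 1) div n + 1"
  have *: "2 * a + 2 * q * card (nbh W v) \<le> degsum (W - insert v (nbh W v)) + 2 * (card (nbh W v))\<^sup>2"
    if v: "v \<in> W" for v
  proof -
    let ?U = "W - insert v (nbh W v)" and ?d = "card (nbh W v)"
    have "insert v (nbh W v) \<subseteq> W"
      using v nbh_subset by auto
    moreover have vN: "v \<notin> nbh W v"
      using no_loop by (simp add: nbh_def)
    ultimately have U: "card ?U = n - 1 - ?d" and d: "?d < n"
      using fin n card_mono[of W "insert v (nbh W v)"] by (auto simp: card_Diff_subset)
    have "card ?U < l \<and> 2 * e (card ?U) \<le> degsum ?U"
      using v by (intro IH indep_remove_nbh[OF fin v \<alpha>]) auto
    moreover have "?d \<le> Suc k" using \<alpha> by (rule card_nbh_le)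
    ultimately show ?thesis
      using cert[of ?d] d unfolding U a_def[symmetric] by (simp add: algebra_simps)
  qed
  have "n * degsum W \<ge> (\<Sum>v\<in>W. 2 * a + 2 * q * card (nbh W v))"
    unfolding n[symmetric] sum_degsum_remove_nbh[OF fin] by (intro sum_mono *)
  also have "(\<Sum>v\<in>W. 2 * a + 2 * q * card (nbh W v)) = 2 * (n * a) + 2 * q * degsum W"
    by (simp add: sum.distrib n degsum_def sum_distrib_left)
  finally have "2 * (n * a) \<le> (n - 2 * q) * degsum W"
    by (simp add: diff_mult_distrib)
  moreover have "(n - 2 * q) * (T - 1) < n * a"
    unfolding a_def using q by (simp add: dividend_less_times_div)
  ultimately have "2 * ((n - 2 * q) * (T - 1)) < (n - 2 * q) * degsum W"
    by linarith
  then have "(n - 2 * q) * (2 * (T - 1)) < (n - 2 * q) * degsum W"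
    by (simp only: mult.left_commute)
  then have "2 * (T - 1) < degsum W"
    by simp
  with even_degsum[OF fin] T show ?thesis
    by (auto elim!: evenE)
qed

lemma degsum_le:
  assumes "finite W" "\<And>I. indep_set W E I \<Longrightarrow> card I \<le> k"
  shows "degsum W \<le> card W * k"
  unfolding degsum_def using card_nbh_le[OF assms(2)] sum_bounded_above[of W "\<lambda>v. card (nbh W v)" k] by simp

end

text \<open>
  The edge counts \<open>e\<close> of triangle-free graphs on \<open>n\<close> vertices with independence number at most
  \<open>k + 1\<close> satisfy \<open>n e = (\<Sum>v. e\<^sub>v + d(v)\<^sup>2)\<close>, where \<open>e\<^sub>v\<close> counts the edges among the
  non-neighbours of \<open>v\<close>. A lower bound \<open>T\<close> for \<open>e\<close> is therefore the value of a linear program over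
  degree distributions; \<open>q\<close> is a dual solution, the multiplier of \<open>(\<Sum>v. d(v)) = 2 e\<close>. A list
  \<open>es\<close> holds the bounds for a given \<open>k\<close>, and graphs with \<open>length es\<close> or more vertices do not exist:
  there the bound \<open>n k div 2 + 1\<close> contradicts the maximum degree.
\<close>

definition cert_ok :: "nat list \<Rightarrow> nat \<Rightarrow> nat \<Rightarrow> nat \<Rightarrow> nat \<Rightarrow> bool" where
  "cert_ok es k n T q \<longleftrightarrow> 2 * q < n \<and> (\<forall>d\<in>set [0..<Suc k]. d < n \<longrightarrow> n - 1 - d < length es \<longrightarrow>
     (n - 2 * q) * (T - 1) div n + 1 + q * d \<le> d * d + es ! (n - 1 - d))"

text \<open>Multipliers below 7 suffice for all rows used below, so they are searched for rather
  than listed.\<close>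

definition row_ok :: "nat list \<Rightarrow> nat \<Rightarrow> nat list \<Rightarrow> bool" where
  "row_ok es k fs \<longleftrightarrow>
     (\<forall>n\<in>set [0..<length fs]. fs ! n = 0 \<or> list_ex (cert_ok es k n (fs ! n)) [0..<7]) \<and>
     list_ex (cert_ok es k (length fs) (length fs * k div 2 + 1)) [0..<7]"

context triangle_free begin

definition edge_bound :: "nat \<Rightarrow> nat list \<Rightarrow> bool" where
  "edge_bound k es \<longleftrightarrow> (\<forall>W. finite W \<and> (\<forall>I. indep_set W E I \<longrightarrow> card I \<le> k) \<longrightarrow>
     card W < length es \<and> 2 * es ! card W \<le> degsum W)"

lemma edge_bound_0: "edge_bound 0 [0]"
proof -
  have "W = {}" if "\<forall>I. indep_set W E I \<longrightarrow> card I \<le> 0" for W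
  proof (rule ccontr)
    assume "W \<noteq> {}"
    then obtain v where "v \<in> W" by blast
    then have "indep_set W E {v}"
      by (simp add: indep_set_def)
    with that have "card {v} \<le> 0" by blast
    then show False by simp
  qed
  then show ?thesis
    unfolding edge_bound_def by fastforce
qed

lemma edge_bound_Suc:
  assumes es: "edge_bound k es" and ok: "row_ok es (Suc k) fs"
  shows "edge_bound (Suc k) fs"
  unfolding edge_bound_def
proof (intro allI impI, elim conjE)
  fix W
  assume fin: "finite W" and \<alpha>: "\<forall>I. indep_set W E I \<longrightarrow> card I \<le> Suc k"
  have bound: "2 * T \<le> degsum U" if "U \<subseteq> W" "cert_ok es (Suc k) (card U) T q" "0 < T" for U T q
  proof (rule degsum_bound[where k = k and l = "length es" and e = "\<lambda>n. es ! n" and q = q and n = "card U"])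
    show "finite U" using that(1) fin finite_subset by blast
    show "card I \<le> Suc k" if "indep_set U E I" for I
      using that \<alpha> \<open>U \<subseteq> W\<close> by (auto simp: indep_set_def)
    show "card X < length es \<and> 2 * es ! card X \<le> degsum X"
      if "X \<subset> U" "\<And>I. indep_set X E I \<Longrightarrow> card I \<le> k" for X
      using that \<open>finite U\<close> es finite_subset[of X U] unfolding edge_bound_def by blast
    show "(card U - 2 * q) * (T - 1) div card U + 1 + q * d \<le> d\<^sup>2 + es ! (card U - 1 - d)"
      if "d \<le> Suc k" "d < card U" "card U - 1 - d < length es" for d
    proof -
      have "d \<in> set [0..<Suc (Suc k)]"
        using that(1) by auto
      with that \<open>cert_ok es (Suc k) (card U) T q\<close> show ?thesis
        unfolding cert_ok_def power2_eq_square by blast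
    qed
    show "2 * q < card U"
      using that(2) by (simp add: cert_ok_def)
    show "0 < T" by fact
  qed simp
  have "card W < length fs"
  proof (rule ccontr)
    assume "\<not> card W < length fs"
    \<comment> \<open>Passing to exactly \<open>length fs\<close> vertices lets one certificate
      exclude all larger orders.\<close>
    then obtain U where U: "U \<subseteq> W" "card U = length fs"
      by (meson not_less obtain_subset_with_card_n)
    then obtain q where "cert_ok es (Suc k) (card U) (card U * Suc k div 2 + 1) q"
      using ok by (auto simp: row_ok_def list_ex_iff)
    from bound[OF U(1) this] have "2 * (card U * Suc k div 2 + 1) \<le> degsum U"
      by simp
    moreover have "degsum U \<le> card U * Suc k"
      using \<alpha> U(1) fin finite_subset by (intro degsum_le) (auto simp: indep_set_def)
    ultimately show False by presburger
  qed
  moreover from this have "fs ! card W = 0 \<or> (\<exists>q. cert_ok es (Suc k) (card W) (fs ! card W) q)"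
    using ok by (auto simp: row_ok_def list_ex_iff)
  ultimately show "card W < length fs \<and> 2 * fs ! card W \<le> degsum W"
    using bound[of W] by (cases "fs ! card W = 0") auto
qed

text \<open>The lengths 3, 6, 9, 14, 19, 24, 30, 37 are upper bounds for R(3, 2) up to R(3, 9). The
  first four are exact; the others are slightly too large but enough for
  \<open>ex_indep_set_odd\<close>.\<close>

lemma edge_bound_8:
  "edge_bound 1 [0, 0, 1]"
  "edge_bound 2 [0, 0, 0, 1, 2, 5]"
  "edge_bound 3 [0, 0, 0, 0, 1, 2, 3, 6, 10]"
  "edge_bound 4 [0, 0, 0, 0, 0, 1, 2, 3, 4, 7, 10, 15, 20, 26]"
  "edge_bound 5 [0, 0, 0, 0, 0, 0, 1, 2, 3, 4, 5, 8, 11, 15, 19, 25, 31, 38, 45]"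
  "edge_bound 6 [0, 0, 0, 0, 0, 0, 0, 1, 2, 3, 4, 5, 6, 9, 12, 15, 20, 24, 29, 35, 42, 49, 57, 66]"
  "edge_bound 7 [0, 0, 0, 0, 0, 0, 0, 0, 1, 2, 3, 4, 5, 6, 7, 10, 13, 16, 20, 24, 29, 34, 40, 45,
     52, 60, 68, 77, 86, 97]"
  "edge_bound 8 [0, 0, 0, 0, 0, 0, 0, 0, 0, 1, 2, 3, 4, 5, 6, 7, 8, 11, 14, 17, 20, 25, 29, 33,
     39, 45, 50, 57, 63, 70, 78, 87, 96, 107, 117, 128, 140]"
proof -
  have step: "edge_bound j es \<Longrightarrow> row_ok es k fs \<Longrightarrow> k = Suc j \<Longrightarrow> edge_bound k fs" for j k es fs
    using edge_bound_Suc by simp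
  show 1: "edge_bound 1 [0, 0, 1]"
    by (rule step[OF edge_bound_0], code_simp) simp
  show 2: "edge_bound 2 [0, 0, 0, 1, 2, 5]"
    by (rule step[OF 1], code_simp) simp
  show 3: "edge_bound 3 [0, 0, 0, 0, 1, 2, 3, 6, 10]"
    by (rule step[OF 2], code_simp) simp
  show 4: "edge_bound 4 [0, 0, 0, 0, 0, 1, 2, 3, 4, 7, 10, 15, 20, 26]"
    by (rule step[OF 3], code_simp) simp
  show 5: "edge_bound 5 [0, 0, 0, 0, 0, 0, 1, 2, 3, 4, 5, 8, 11, 15, 19, 25, 31, 38, 45]"
    by (rule step[OF 4], code_simp) simp
  show 6: "edge_bound 6 [0, 0, 0, 0, 0, 0, 0, 1, 2, 3, 4, 5, 6, 9, 12, 15, 20, 24, 29, 35, 42, 49, 57, 66]"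
    by (rule step[OF 5], code_simp) simp
  show 7: "edge_bound 7 [0, 0, 0, 0, 0, 0, 0, 0, 1, 2, 3, 4, 5, 6, 7, 10, 13, 16, 20, 24, 29, 34, 40, 45,
     52, 60, 68, 77, 86, 97]"
    by (rule step[OF 6], code_simp) simp
  show "edge_bound 8 [0, 0, 0, 0, 0, 0, 0, 0, 0, 1, 2, 3, 4, 5, 6, 7, 8, 11, 14, 17, 20, 25, 29, 33,
     39, 45, 50, 57, 63, 70, 78, 87, 96, 107, 117, 128, 140]"
    by (rule step[OF 7], code_simp) simp
qed

lemma ex_indep_set:
  assumes "edge_bound k es" "finite W" "length es \<le> card W"
  shows "\<exists>I. indep_set W E I \<and> k < card I"
  using assms unfolding edge_bound_def by (meson leD leI)

lemma ex_indep_set_gt: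
  assumes "finite W" "(k, n) \<in> {(1, 3), (2, 6), (3, 9), (4, 14), (5, 19), (6, 24), (7, 30), (8, 37)}" "n \<le> card W"
  shows "\<exists>I. indep_set W E I \<and> k < card I"
  using assms(2)
  by (elim insertE; (simp only: prod.inject emptyE)?; elim conjE emptyE; hypsubst)
    (rule edge_bound_8[THEN ex_indep_set], use assms(1,3) in simp_all)+

end

section \<open>Matchings in triangle-free graphs\<close>

context triangle_free begin

definition matching :: "'a set \<Rightarrow> 'a set set \<Rightarrow> bool" where
  "matching W M \<longleftrightarrow> M \<subseteq> E \<and> \<Union>M \<subseteq> W \<and> pairwise disjnt M"

definition \<nu> :: "'a set \<Rightarrow> nat" where
  "\<nu> W = Max (card ` {M. matching W M})"

definition max_matching :: "'a set \<Rightarrow> 'a set set \<Rightarrow> bool" where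
  "max_matching W M \<longleftrightarrow> matching W M \<and> card M = \<nu> W"

lemma finite_matchings: "finite W \<Longrightarrow> finite {M. matching W M}"
  by (rule finite_subset[of _ "Pow (Pow W)"]) (auto simp: matching_def)

lemma finite_matching: "finite W \<Longrightarrow> matching W M \<Longrightarrow> finite M"
  by (metis finite_UnionD finite_subset matching_def)

lemma card_matching_le: "finite W \<Longrightarrow> matching W M \<Longrightarrow> card M \<le> \<nu> W"
  unfolding \<nu>_def by (intro Max_ge) (auto intro: finite_matchings)

lemma matching_empty: "matching W {}"
  by (simp add: matching_def)

lemma ex_max_matching:
  assumes "finite W"
  obtains M where "max_matching W M"
proof -
  have "\<nu> W \<in> card ` {M. matching W M}"
    unfolding \<nu>_def using assms matching_empty by (intro Max_in) (auto intro: finite_matchings)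
  then show thesis
    using that by (auto simp: max_matching_def)
qed

lemma matching_mono: "matching U M \<Longrightarrow> U \<subseteq> W \<Longrightarrow> matching W M"
  by (auto simp: matching_def)

lemma \<nu>_mono: "finite W \<Longrightarrow> U \<subseteq> W \<Longrightarrow> \<nu> U \<le> \<nu> W"
  using ex_max_matching[of U] card_matching_le matching_mono
  by (metis finite_subset max_matching_def)

lemma card_Union_matching:
  assumes "matching W M"
  shows "card (\<Union>M) = 2 * card M"
proof -
  have "card e = 2 \<and> finite e" if "e \<in> M" for e
    using that assms edge_card[of e] card.infinite[of e] unfolding matching_def
    by (metis subsetD zero_neq_numeral)
  then have "card (\<Union>M) = sum card M"
    using assms by (intro card_Union_disjoint) (auto simp: matching_def)
  then show ?thesis
    using \<open>\<And>e. e \<in> M \<Longrightarrow> card e = 2 \<and> finite e\<close> by simp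
qed

lemma matching_insert:
  assumes "matching W M" "e \<in> E" "e \<subseteq> W" "e \<inter> \<Union>M = {}"
  shows "matching W (insert e M)" "e \<notin> M"
proof -
  show "matching W (insert e M)"
    using assms unfolding matching_def pairwise_insert disjnt_def by blast
  show "e \<notin> M"
    using assms(4) edge_card[OF assms(2)] by (metis Int_absorb2 Sup_upper card.empty zero_neq_numeral)
qed

lemma max_matching_edge:
  assumes "finite W" "max_matching W M" "e \<in> E" "e \<subseteq> W"
  shows "e \<inter> \<Union>M \<noteq> {}"
proof
  assume "e \<inter> \<Union>M = {}"
  then have "matching W (insert e M)" "e \<notin> M"
    using matching_insert assms by (auto simp: max_matching_def)
  then show False
    using assms(1,2) card_matching_le[of W "insert e M"] finite_matching[of W M]
    by (simp add: max_matching_def)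
qed

text \<open>Gallai's relation. If every vertex is missed by some maximum matching, it is an
  equivalence relation together with equality (\<open>apart_trans\<close>), and
  \<open>apart_edge\<close> keeps all edges inside its classes.\<close>

definition apart :: "'a set \<Rightarrow> 'a \<Rightarrow> 'a \<Rightarrow> bool" where
  "apart W u v \<longleftrightarrow> (\<forall>M. max_matching W M \<longrightarrow> u \<in> \<Union>M \<or> v \<in> \<Union>M)"

lemma apart_edge:
  assumes "finite W" "{u, v} \<in> E" "u \<in> W" "v \<in> W"
  shows "apart W u v"
  using max_matching_edge[OF assms(1) _ assms(2)] assms(3,4) by (auto simp: apart_def)

text \<open>The exchange argument of Gallai's lemma.\<close>

lemma apart_trans:
  assumes fin: "finite W" and t: "\<exists>N. max_matching W N \<and> t \<notin> \<Union>N"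
    and ut: "apart W u t" and tv: "apart W t v" and "u \<noteq> v"
  shows "apart W u v"
  unfolding apart_def
proof (intro allI impI, rule ccontr)
  fix M assume M: "max_matching W M" and "\<not> (u \<in> \<Union>M \<or> v \<in> \<Union>M)"
  then have uM: "u \<notin> \<Union>M" and vM: "v \<notin> \<Union>M" by auto
  have fM: "finite M" using M fin finite_matching by (auto simp: max_matching_def)
  \<comment> \<open>Among the maximum matchings missing \<open>t\<close>, \<open>N\<close> overlaps
    \<open>M\<close> as much as possible; an exchange will increase the overlap.\<close>
  obtain N where N: "max_matching W N" "t \<notin> \<Union>N"
    and Nmax: "\<And>N'. max_matching W N' \<and> t \<notin> \<Union>N' \<Longrightarrow> card (M \<inter> N') \<le> card (M \<inter> N)"
    using ex_has_greatest_nat[of "\<lambda>N. max_matching W N \<and> t \<notin> \<Union>N" _ "\<lambda>N. card (M \<inter> N)" "Suc (card M)"] t fM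
    by (metis Int_lower1 card_mono le_imp_less_Suc)
  have fN: "finite N" using N fin finite_matching by (auto simp: max_matching_def)
  have fU: "finite (\<Union>M)" "finite (\<Union>N)"
    using M N fin by (meson finite_subset matching_def max_matching_def)+
  have "u \<in> \<Union>N" "v \<in> \<Union>N"
    using N ut tv by (auto simp: apart_def)
  \<comment> \<open>\<open>u\<close> and \<open>v\<close> are covered by \<open>N\<close> only. Both
    matchings cover equally many vertices, so at least two are covered by \<open>M\<close> only, one
    of them different from \<open>t\<close>.\<close>
  with uM vM have "{u, v} \<subseteq> \<Union>N - \<Union>M" by auto
  with fU \<open>u \<noteq> v\<close> have "2 \<le> card (\<Union>N - \<Union>M)"
    by (metis card_2_iff card_mono finite_Diff)
  moreover have "card (\<Union>N) = card (\<Union>M)"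
    using M N card_Union_matching by (metis max_matching_def)
  ultimately have "2 \<le> card (\<Union>M - \<Union>N)"
    using fU by (simp add: card_Diff_subset_Int Int_commute)
  then have "\<not> \<Union>M - \<Union>N \<subseteq> {t}"
    by (metis card_mono card.insert card.empty finite.emptyI finite_insert empty_iff not_less_eq_eq numeral_2_eq_2 le_trans)
  then obtain x e where x: "x \<in> e" "e \<in> M" "x \<notin> \<Union>N" "x \<noteq> t" by auto
  have ME: "M \<subseteq> E" "\<Union>M \<subseteq> W" "pairwise disjnt M" and NE: "N \<subseteq> E" "\<Union>N \<subseteq> W" "pairwise disjnt N"
    using M N by (auto simp: max_matching_def matching_def)
  have "card e = 2" using edge_card ME(1) x(2) by blast
  then obtain y where y: "e = {x, y}" "x \<noteq> y"
    using x(1) by (metis card_2_iff doubleton_eq_iff insertE singletonD)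
  have "e \<inter> \<Union>N \<noteq> {}"
    using max_matching_edge[OF fin N(1), of e] ME x(2) by blast
  with y x(3) have "y \<in> \<Union>N" by auto
  then obtain f where f: "f \<in> N" "y \<in> f" by auto
  have "f \<noteq> e" using x f by auto
  then have "f \<notin> M"
    using pairwiseD[OF ME(3), of f e] x(2) y f(2) by (auto simp: disjnt_def)
  \<comment> \<open>Trading \<open>f\<close> for \<open>e\<close> keeps the size and still misses
    \<open>t\<close>, but gains an edge of \<open>M\<close> and loses none.\<close>
  define N' where "N' = insert e (N - {f})"
  have "matching W (N - {f})"
    using NE by (auto simp: matching_def pairwise_def)
  moreover have "e \<in> E" "e \<subseteq> W"
    using ME x(2) by auto
  moreover have "e \<inter> \<Union>(N - {f}) = {}"
  proof -
    have "y \<notin> g" if "g \<in> N - {f}" for g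
      using that f pairwiseD[OF NE(3), of g f] by (auto simp: disjnt_def)
    with x(3) y show ?thesis by auto
  qed
  ultimately have "matching W N'" "e \<notin> N - {f}"
    unfolding N'_def by (rule matching_insert)+
  moreover have "card N' = card N"
    using \<open>e \<notin> N - {f}\<close> fN f(1) card_Suc_Diff1[of N f] unfolding N'_def by simp
  ultimately have "max_matching W N'"
    using N(1) by (simp add: max_matching_def)
  moreover have "t \<notin> \<Union>N'"
    using N(2) x(4) y \<open>y \<in> \<Union>N\<close> unfolding N'_def by auto
  ultimately have "card (M \<inter> N') \<le> card (M \<inter> N)"
    using Nmax by blast
  moreover have "M \<inter> N' = insert e (M \<inter> N)" "e \<notin> M \<inter> N"
    using \<open>f \<notin> M\<close> x unfolding N'_def by auto
  ultimately show False
    using fM by simp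
qed

lemma \<nu>_add_le:
  assumes "finite W" "U \<subseteq> W"
  shows "\<nu> U + \<nu> (W - U) \<le> \<nu> W"
proof -
  obtain M N where M: "max_matching U M" and N: "max_matching (W - U) N"
    using assms by (meson ex_max_matching finite_Diff finite_subset)
  have E: "M \<subseteq> E" and U: "\<Union>M \<subseteq> U" "\<Union>N \<subseteq> W - U"
    using M N by (auto simp: max_matching_def matching_def)
  have disj: "M \<inter> N = {}"
  proof (rule ccontr)
    assume "M \<inter> N \<noteq> {}"
    then obtain e where "e \<in> M" "e \<in> N" by auto
    then have "e = {}" "e \<in> E" using U E by blast+
    then show False using edge_card by force
  qed
  have fin: "finite M" "finite N"
    using M N assms finite_matching unfolding max_matching_def by (meson finite_Diff finite_subset)+
  have "disjnt e f" if "e \<in> M" "f \<in> N" for e f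
    using that U by (auto simp: disjnt_def)
  then have "matching W (M \<union> N)"
    using M N assms(2) unfolding max_matching_def matching_def pairwise_def
    by (auto simp: disjnt_sym; blast)
  from card_matching_le[OF assms(1) this] show ?thesis
    using M N fin disj by (simp add: max_matching_def card_Un_disjoint)
qed

text \<open>\<open>F\<close> bounds how far the independence number falls below
  \<open>card W - \<nu> W\<close>. A vertex whose deletion lowers \<open>\<nu>\<close> is deleted.
  Otherwise Gallai's argument applies: if all vertices form one class, a maximum matching leaves out
  exactly one vertex and \<open>odd\<close> applies; if not, no edge leaves a class, so independent
  sets of the class and of the rest unite, and \<open>F\<close> is superadditive.\<close>

theorem ex_large_indep_set:
  fixes F :: "nat \<Rightarrow> nat"
  assumes mono: "\<And>a b. a \<le> b \<Longrightarrow> F a \<le> F b"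
    and superadd: "\<And>a b. a + b \<le> c \<Longrightarrow> F a + F b \<le> F (a + b)"
    and odd: "\<And>a U. a \<le> c \<Longrightarrow> finite U \<Longrightarrow> card U = 2 * a + 1 \<Longrightarrow> \<exists>I. indep_set U E I \<and> a + 1 \<le> card I + F a"
    and "finite W" "\<nu> W \<le> c"
  shows "\<exists>I. indep_set W E I \<and> card W \<le> card I + \<nu> W + F (\<nu> W)"
  using assms(4,5)
proof (induction W rule: finite_psubset_induct)
  case (psubset W)
  consider "W = {}" | v where "v \<in> W" "\<nu> (W - {v}) \<noteq> \<nu> W"
    | v where "v \<in> W" "\<forall>v\<in>W. \<nu> (W - {v}) = \<nu> W" by blast
  then show ?case
  proof cases
    case 1
    then show ?thesis by (auto simp: indep_set_def)
  next
    case (2 v)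
    then have lt: "\<nu> (W - {v}) < \<nu> W"
      using \<nu>_mono[OF psubset(1), of "W - {v}"] by (simp add: order.strict_iff_order)
    then obtain I where "indep_set (W - {v}) E I"
        "card (W - {v}) \<le> card I + \<nu> (W - {v}) + F (\<nu> (W - {v}))"
      using psubset.IH[of "W - {v}"] psubset.prems 2(1) by auto
    moreover have "F (\<nu> (W - {v})) \<le> F (\<nu> W)"
      using lt by (intro mono) simp
    moreover have "card W = Suc (card (W - {v}))"
      using psubset(1) 2(1) by (metis card_Suc_Diff1)
    ultimately show ?thesis
      using lt by (intro exI[of _ I]) (auto simp: indep_set_def)
  next
    case (3 v)
    \<comment> \<open>A maximum matching of \<open>W - {u}\<close> is also maximum in
      \<open>W\<close>, since no deletion lowers \<open>\<nu>\<close> here.\<close>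
    have missed: "\<exists>M. max_matching W M \<and> u \<notin> \<Union>M" if "u \<in> W" for u
    proof -
      obtain M where "max_matching (W - {u}) M"
        using psubset(1) by (meson ex_max_matching finite_Diff)
      then show ?thesis
        using that 3(2) matching_mono[of "W - {u}" M W]
        by (intro exI[of _ M]) (auto simp: max_matching_def matching_def)
    qed
    define C where "C = {u \<in> W. u = v \<or> apart W v u}"
    have CW: "C \<subseteq> W" "v \<in> C" using 3(1) by (auto simp: C_def)
    show ?thesis
    proof (cases "C = W")
      case True
      obtain M where M: "max_matching W M" "v \<notin> \<Union>M"
        using missed 3(1) by blast
      have "u \<in> \<Union>M" if "u \<in> W" "u \<noteq> v" for u
        using that True M by (auto simp: C_def apart_def)
      moreover have "\<Union>M \<subseteq> W"
        using M by (auto simp: max_matching_def matching_def)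
      ultimately have "W = insert v (\<Union>M)"
        using M(2) 3(1) by auto
      then have "card W = Suc (card (\<Union>M))"
        using psubset(1) M(2) by (metis card_insert_disjoint finite_insert)
      then have "card W = 2 * \<nu> W + 1"
        using M(1) card_Union_matching by (auto simp: max_matching_def)
      moreover from this obtain I where "indep_set W E I" "\<nu> W + 1 \<le> card I + F (\<nu> W)"
        using odd psubset.prems psubset(1) by blast
      ultimately show ?thesis by (intro exI[of _ I]) simp
    next
      case False
      have no_edge: "{x, y} \<notin> E" if "x \<in> C" "y \<in> W - C" for x y
      proof
        assume "{x, y} \<in> E"
        then have "apart W x y"
          using that CW by (intro apart_edge[OF psubset(1)]) auto
        moreover have "v = x \<or> apart W v x" "v \<noteq> y" "x \<in> W"
          using that CW by (auto simp: C_def)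
        ultimately have "apart W v y"
          using apart_trans[OF psubset(1) missed, of x v y] by blast
        with that show False by (auto simp: C_def)
      qed
      have le: "\<nu> C + \<nu> (W - C) \<le> \<nu> W"
        using \<nu>_add_le[OF psubset(1) CW(1)] .
      obtain I where I: "indep_set C E I" "card C \<le> card I + \<nu> C + F (\<nu> C)"
        using psubset.IH[of C] False CW le psubset.prems by auto
      obtain J where J: "indep_set (W - C) E J" "card (W - C) \<le> card J + \<nu> (W - C) + F (\<nu> (W - C))"
        using psubset.IH[of "W - C"] CW le psubset.prems by auto
      have "indep_set W E (I \<union> J)"
        using I(1) J(1) CW no_edge unfolding indep_set_def
        by (auto simp: subset_iff) (metis insert_commute)+
      moreover have "card (I \<union> J) = card I + card J"
        using I(1) J(1) CW psubset(1) unfolding indep_set_def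
        by (intro card_Un_disjoint) (auto intro: finite_subset)
      moreover have "card W = card C + card (W - C)"
        using CW(1) psubset(1) by (metis card_Diff_subset card_mono finite_subset le_add_diff_inverse)
      moreover have "F (\<nu> C) + F (\<nu> (W - C)) \<le> F (\<nu> W)"
        using superadd[of "\<nu> C" "\<nu> (W - C)"] mono[OF le] le psubset.prems by simp
      ultimately show ?thesis
        using I(2) J(2) le by (intro exI[of _ "I \<union> J"]) simp
    qed
  qed
qed

end

section \<open>Colourings\<close>

text \<open>Classes may be empty, so this says that the chromatic number is at most
  \<open>m\<close>. The form follows the partitions in \<open>vertex_arrows\<close>.\<close>

definition colorable :: "'a set \<Rightarrow> 'a set set \<Rightarrow> nat \<Rightarrow> bool" where
  "colorable V E m \<longleftrightarrow> (\<exists>P :: nat \<Rightarrow> 'a set. (\<Union>i<m. P i) = V \<and>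
     (\<forall>i<m. \<forall>j<m. i \<noteq> j \<longrightarrow> P i \<inter> P j = {}) \<and> (\<forall>i<m. indep_set V E (P i)))"

lemma clique_mono: "clique U E S \<Longrightarrow> U \<subseteq> V \<Longrightarrow> clique V E S"
  by (auto simp: clique_def)

lemma indep_set_mono: "indep_set U E S \<Longrightarrow> U \<subseteq> V \<Longrightarrow> indep_set V E S"
  by (auto simp: indep_set_def)

lemma ex_edge_iff_not_indep:
  assumes "P \<subseteq> V"
  shows "(\<exists>S. S \<subseteq> P \<and> clique V E S \<and> card S = 2) \<longleftrightarrow> \<not> indep_set V E P"
proof
  assume "\<exists>S. S \<subseteq> P \<and> clique V E S \<and> card S = 2"
  then obtain x y where "{x, y} \<subseteq> P" "clique V E {x, y}" "x \<noteq> y"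
    by (metis card_2_iff)
  then show "\<not> indep_set V E P"
    by (auto simp: clique_def indep_set_def)
next
  assume "\<not> indep_set V E P"
  then obtain x y where "x \<in> P" "y \<in> P" "x \<noteq> y" "{x, y} \<in> E"
    using assms by (auto simp: indep_set_def)
  then show "\<exists>S. S \<subseteq> P \<and> clique V E S \<and> card S = 2"
    using assms by (intro exI[of _ "{x, y}"]) (auto simp: clique_def insert_commute)
qed

lemma vertex_arrows_iff_not_colorable:
  "vertex_arrows V E (replicate r 2) \<longleftrightarrow> \<not> colorable V E r"
proof -
  have *: "(\<exists>i<r. \<exists>S. S \<subseteq> P i \<and> clique V E S \<and> card S = replicate r 2 ! i) \<longleftrightarrow>
      \<not> (\<forall>i<r. indep_set V E (P i))" if "(\<Union>i<r. P i) = V" for P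
  proof -
    have "(\<exists>S. S \<subseteq> P i \<and> clique V E S \<and> card S = replicate r 2 ! i) \<longleftrightarrow> \<not> indep_set V E (P i)"
      if "i < r" for i
      using that \<open>(\<Union>i<r. P i) = V\<close> ex_edge_iff_not_indep[of "P i" V E] by auto
    then show ?thesis by blast
  qed
  have "((\<Union>i<r. P i) = V \<and> (\<forall>i<r. \<forall>j<r. i \<noteq> j \<longrightarrow> P i \<inter> P j = {}) \<longrightarrow>
       (\<exists>i<r. \<exists>S. S \<subseteq> P i \<and> clique V E S \<and> card S = replicate r 2 ! i)) \<longleftrightarrow>
     \<not> ((\<Union>i<r. P i) = V \<and> (\<forall>i<r. \<forall>j<r. i \<noteq> j \<longrightarrow> P i \<inter> P j = {}) \<and>
       (\<forall>i<r. indep_set V E (P i)))" for P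
  proof (cases "(\<Union>i<r. P i) = V")
    case True
    show ?thesis
      by (simp only: *[OF True] True imp_conv_disj de_Morgan_conj simp_thms)
  qed simp
  then show ?thesis
    by (simp only: vertex_arrows_def colorable_def length_replicate not_ex)
qed

lemma colorable_Suc:
  assumes "indep_set V E I" "colorable (V - I) E m"
  shows "colorable V E (Suc m)"
proof -
  obtain P where P: "(\<Union>i<m. P i) = V - I" "\<And>i j. i < m \<Longrightarrow> j < m \<Longrightarrow> i \<noteq> j \<Longrightarrow> P i \<inter> P j = {}"
      "\<And>i. i < m \<Longrightarrow> indep_set (V - I) E (P i)"
    using assms(2) by (auto simp: colorable_def)
  have I: "I \<subseteq> V" using assms(1) by (simp add: indep_set_def)
  have PI: "P i \<inter> I = {}" if "i < m" for i
    using P(1) that by blast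
  have "(\<Union>i<Suc m. (P(m := I)) i) = (\<Union>i<m. P i) \<union> I"
    by (auto simp: lessThan_Suc)
  then have "(\<Union>i<Suc m. (P(m := I)) i) = V"
    using P(1) I by auto
  moreover have "indep_set V E ((P(m := I)) i)" if "i < Suc m" for i
    using that assms(1) P(3) indep_set_mono[of "V - I"] by (cases "i = m") auto
  moreover have "(P(m := I)) i \<inter> (P(m := I)) j = {}" if "i < Suc m" "j < Suc m" "i \<noteq> j" for i j
    using that P(2) PI by (auto simp: less_Suc_eq Int_commute)
  ultimately show ?thesis
    unfolding colorable_def by blast
qed

lemma colorable_disjoint_indep:
  assumes "finite M" "pairwise disjnt M" "\<And>e. e \<in> M \<Longrightarrow> indep_set V E e"
    and "colorable (V - \<Union>M) E m"
  shows "colorable V E (m + card M)"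
  using assms
proof (induction M arbitrary: m)
  case (insert e M)
  have e: "e \<inter> \<Union>M = {}"
    using insert.prems(1) insert.hyps(2) by (auto simp: pairwise_insert disjnt_def)
  have "indep_set (V - \<Union>M) E e"
    using insert.prems(2)[of e] e by (auto simp: indep_set_def)
  moreover have "V - \<Union>(insert e M) = V - \<Union>M - e" by auto
  ultimately have "colorable (V - \<Union>M) E (Suc m)"
    using insert.prems(3) by (metis colorable_Suc)
  then have "colorable V E (Suc m + card M)"
    using insert.prems by (intro insert.IH) (auto simp: pairwise_insert)
  then show ?case using insert.hyps by simp
qed simp

lemma colorable_mono:
  assumes "colorable V E m" "m \<le> n"
  shows "colorable V E n"
proof -
  have "indep_set V E {}" by (simp add: indep_set_def)
  then have "colorable V E (m + d)" for d
    using assms(1) by (induction d) (auto intro: colorable_Suc[of V E "{}"])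
  from this[of "n - m"] assms(2) show ?thesis by simp
qed

lemma colorable_card:
  assumes "finite V"
  shows "colorable V E (card V)"
proof -
  have "colorable V E (0 + card ((\<lambda>v. {v}) ` V))"
    using assms by (intro colorable_disjoint_indep)
      (auto simp: pairwise_image pairwise_def indep_set_def disjnt_def colorable_def)
  then show ?thesis by (simp add: card_image)
qed

section \<open>Complements, and cliques in graphs of large chromatic number\<close>

definition complement :: "'a set \<Rightarrow> 'a set set \<Rightarrow> 'a set set" where
  "complement V E = {{x, y} |x y. x \<in> V \<and> y \<in> V \<and> x \<noteq> y \<and> {x, y} \<notin> E}"

lemma in_complement_iff:
  "{x, y} \<in> complement V E \<longleftrightarrow> x \<in> V \<and> y \<in> V \<and> x \<noteq> y \<and> {x, y} \<notin> E"
  by (auto simp: complement_def doubleton_eq_iff insert_commute)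

lemma indep_set_complement: "W \<subseteq> V \<Longrightarrow> indep_set W (complement V E) S \<longleftrightarrow> clique W E S"
  by (auto simp: indep_set_def clique_def in_complement_iff subset_iff)

lemma clique_complement: "W \<subseteq> V \<Longrightarrow> clique W (complement V E) S \<longleftrightarrow> indep_set W E S"
  by (auto simp: indep_set_def clique_def in_complement_iff subset_iff)

lemma graph_complement: "finite V \<Longrightarrow> graph V (complement V E)"
  by (auto simp: graph_def complement_def)

lemma triangle_free_complement:
  assumes "\<And>I. indep_set V E I \<Longrightarrow> card I \<noteq> 3"
  shows "triangle_free (complement V E)"
proof
  show "card e = 2" if "e \<in> complement V E" for e
    using that by (auto simp: complement_def)
  fix x y z assume *: "{x, y} \<in> complement V E" "{y, z} \<in> complement V E"
  show "{x, z} \<notin> complement V E"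
  proof
    assume "{x, z} \<in> complement V E"
    with * have "card {x, y, z} = 3" "indep_set V E {x, y, z}"
      by (auto simp: in_complement_iff indep_set_def insert_commute)
    with assms show False by blast
  qed
qed

text \<open>Removing an independent triple turns \<open>m\<close> and \<open>c\<close> into
  \<open>m - 1\<close> and \<open>c - 2\<close>, which \<open>step\<close> pays for. Without such
  triples the complement is triangle-free and its large independent set is a clique; a colouring
  from a maximum matching of the complement shows \<open>\<nu> V \<le> c\<close>.\<close>

lemma uncolorable_imp_clique:
  fixes F :: "nat \<Rightarrow> nat" and V :: "'a set"
  assumes mono: "\<And>a b. a \<le> b \<Longrightarrow> F a \<le> F b"
    and superadd: "\<And>a b. a + b \<le> N \<Longrightarrow> F a + F b \<le> F (a + b)"
    and step: "\<And>a. a + 2 \<le> N \<Longrightarrow> F a + 1 \<le> F (a + 2)"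
    and odd: "\<And>(E :: 'a set set) U a. triangle_free E \<Longrightarrow> finite U \<Longrightarrow> a \<le> N \<Longrightarrow> card U = 2 * a + 1 \<Longrightarrow>
                \<exists>I. indep_set U E I \<and> a + 1 \<le> card I + F a"
    and "finite V" "\<not> colorable V E m" "card V \<le> m + 1 + c" "c \<le> N"
  shows "\<exists>S. clique V E S \<and> m + 1 \<le> card S + F c"
  using assms(5-)
proof (induction V arbitrary: m c rule: finite_psubset_induct)
  case (psubset V)
  show ?case
  proof (cases "\<exists>I. indep_set V E I \<and> card I = 3")
    case True
    then obtain I where I: "indep_set V E I" "card I = 3" by blast
    then have IV: "I \<subseteq> V" "finite I" "I \<noteq> {}"
      using psubset(1) by (auto simp: indep_set_def intro: finite_subset)
    then have card: "card V = card (V - I) + 3"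
      using psubset(1) I(2) by (metis card_Diff_subset card_mono le_add_diff_inverse2)
    show ?thesis
    proof (cases "m = 0")
      case True
      obtain v where "v \<in> V" using IV by blast
      then show ?thesis
        using True by (intro exI[of _ "{v}"]) (auto simp: clique_def)
    next
      case False
      have *: "\<not> colorable (V - I) E (m - 1)"
        using colorable_Suc[OF I(1), of "m - 1"] psubset.prems(1) False by auto
      \<comment> \<open>One class per vertex is always a colouring, so at least \<open>m\<close>
        vertices remain, and this forces \<open>c\<close> to be at least 2.\<close>
      have "\<not> card (V - I) \<le> m - 1"
        using * colorable_card[of "V - I" E] colorable_mono psubset(1) by (meson finite_Diff)
      then have "2 \<le> c" using psubset.prems(2) card by linarith
      obtain S where S: "clique (V - I) E S" "m - 1 + 1 \<le> card S + F (c - 2)"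
      proof -
        have "V - I \<subset> V" using IV by blast
        moreover have "card (V - I) \<le> m - 1 + 1 + (c - 2)" "c - 2 \<le> N"
          using psubset.prems card \<open>2 \<le> c\<close> False by linarith+
        ultimately show thesis
          using psubset.IH[of "V - I" "m - 1" "c - 2"] * that by blast
      qed
      moreover have "F (c - 2) + 1 \<le> F c"
        using step[of "c - 2"] psubset.prems(3) unfolding le_add_diff_inverse2[OF \<open>2 \<le> c\<close>] by blast
      ultimately show ?thesis
        using clique_mono[of "V - I" E S V] False by (intro exI[of _ S]) auto
    qed
  next
    case False
    interpret triangle_free "complement V E"
      using False by (intro triangle_free_complement) blast
    obtain M where M: "max_matching V M"
      using psubset(1) ex_max_matching by blast
    then have M': "matching V M" "card M = \<nu> V" "finite M"
      using psubset(1) finite_matching by (auto simp: max_matching_def)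
    have "\<Union>M \<subseteq> V" using M' by (simp add: matching_def)
    then have card: "card (V - \<Union>M) + 2 * card M = card V"
      using psubset(1) card_Union_matching[OF M'(1)]
      by (metis card_Diff_subset card_mono finite_subset le_add_diff_inverse2)
    have "indep_set V E e" if "e \<in> M" for e
    proof -
      have "e \<in> complement V E" using that M'(1) by (auto simp: matching_def)
      then show ?thesis by (auto simp: complement_def indep_set_def insert_commute)
    qed
    \<comment> \<open>Matched pairs and single unmatched vertices form
      \<open>card V - \<nu> V\<close> colour classes.\<close>
    then have "colorable V E (card (V - \<Union>M) + card M)"
      using M' psubset(1) by (intro colorable_disjoint_indep colorable_card) (auto simp: matching_def)
    then have "m < card (V - \<Union>M) + card M"
      using psubset.prems(1) colorable_mono not_less by blast
    then have m: "m + 1 + \<nu> V \<le> card V"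
      using card M'(2) by linarith
    then have \<nu>: "\<nu> V \<le> c"
      using psubset.prems(2) by linarith
    then have "\<nu> V \<le> N"
      using psubset.prems(3) by linarith
    have "\<exists>S. indep_set V (complement V E) S \<and> card V \<le> card S + \<nu> V + F (\<nu> V)"
      using odd[OF triangle_free_axioms]
      by (intro ex_large_indep_set[OF mono superadd _ psubset(1) \<open>\<nu> V \<le> N\<close>])
    then obtain S where "indep_set V (complement V E) S" "card V \<le> card S + \<nu> V + F (\<nu> V)"
      by blast
    moreover have "F (\<nu> V) \<le> F c"
      using mono \<nu> .
    ultimately show ?thesis
      using m by (intro exI[of _ S]) (simp add: indep_set_complement)
  qed
qed

section \<open>Folkman and Ramsey numbers\<close>

lemma finite_cliques:
  assumes "graph V E"
  shows "finite {S. clique V E S}"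
proof (rule finite_subset)
  show "{S. clique V E S} \<subseteq> Pow V" by (auto simp: clique_def)
  show "finite (Pow V)" using assms by (simp add: graph_def)
qed

lemma card_clique_le:
  assumes "graph V E" "clique V E S"
  shows "card S \<le> clique_number V E"
  unfolding clique_number_def using assms(2) finite_cliques[OF assms(1)] by (intro Max_ge) auto

lemma clique_number_less:
  assumes "graph V E" "\<And>S. clique V E S \<Longrightarrow> card S < q"
  shows "clique_number V E < q"
proof -
  have "clique V E {}" by (simp add: clique_def)
  then have "clique_number V E \<in> {card S |S. clique V E S}"
    unfolding clique_number_def using finite_cliques[OF assms(1)] by (intro Max_in) auto
  then show ?thesis
    using assms(2) by auto
qed

lemma F_v_geI:
  assumes "\<And>(V :: nat set) E. graph V E \<Longrightarrow> card V < n \<Longrightarrow> \<not> colorable V E r \<Longrightarrow> \<exists>S. clique V E S \<and> q \<le> card S"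
  shows "enat n \<le> F_v (replicate r 2) q"
  unfolding F_v_def
proof (rule Inf_greatest, clarsimp simp: H_v_def vertex_arrows_iff_not_colorable)
  fix V :: "nat set" and E
  assume *: "graph V E" "\<not> colorable V E r" "clique_number V E < q"
  show "n \<le> card V"
  proof (rule ccontr)
    assume "\<not> n \<le> card V"
    with * obtain S where "clique V E S" "q \<le> card S"
      using assms by (meson not_le)
    with *(1,3) card_clique_le show False by fastforce
  qed
qed

lemma F_v_leI:
  fixes V :: "nat set"
  assumes "graph V E" "\<not> colorable V E r" "\<And>S. clique V E S \<Longrightarrow> card S < q"
  shows "F_v (replicate r 2) q \<le> enat (card V)"
proof -
  have "(V, E) \<in> H_v (replicate r 2) q"
    using assms clique_number_less[of V E q] by (simp add: H_v_def vertex_arrows_iff_not_colorable)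
  then show ?thesis
    unfolding F_v_def by (intro Inf_lower) force
qed

text \<open>Joining a complete graph on \<open>t\<close> new vertices adds at most \<open>t\<close>
  to a clique. Colour classes have at most two vertices, and those meeting the new part only one, so
  \<open>r + t\<close> classes are too few.\<close>

lemma F_v_le_join:
  fixes V :: "nat set"
  assumes graph: "graph V E" and \<alpha>: "\<And>I. indep_set V E I \<Longrightarrow> card I \<le> 2"
    and \<omega>: "\<And>S. clique V E S \<Longrightarrow> card S < q" and r: "2 * r < card V"
  shows "F_v (replicate (r + t) 2) (q + t) \<le> enat (card V + t)"
proof -
  have fin: "finite V" using graph by (simp add: graph_def)
  obtain T where T: "finite T" "card T = t" "T \<subseteq> - V"
    using infinite_arbitrarily_large[of "- V" t] fin by (auto simp: Compl_eq_Diff_UNIV)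
  define E' where "E' = E \<union> {{x, y} |x y. x \<in> T \<and> y \<in> V \<union> T \<and> x \<noteq> y}"
  have EV: "{x, y} \<in> E'" if "{x, y} \<in> E" for x y
    using that by (simp add: E'_def)
  have E'V: "{x, y} \<in> E" if "{x, y} \<in> E'" "x \<in> V" "y \<in> V" for x y
    using that T by (auto simp: E'_def doubleton_eq_iff)
  have E'T: "{x, y} \<in> E'" if "x \<in> T" "y \<in> V \<union> T" "x \<noteq> y" for x y
    using that by (auto simp: E'_def)
  have card: "card (V \<union> T) = card V + t"
    using T fin by (subst card_Un_disjoint) auto
  have "graph (V \<union> T) E'"
    using graph T(1) unfolding graph_def E'_def by auto
  moreover have "card S < q + t" if "clique (V \<union> T) E' S" for S
  proof -
    have "clique V E (S \<inter> V)"
      using that E'V by (auto simp: clique_def)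
    moreover have "card (S \<inter> T) \<le> t"
      using T(1,2) card_mono[of T "S \<inter> T"] by simp
    moreover have "card S \<le> card (S \<inter> V) + card (S \<inter> T)"
    proof -
      have "S = (S \<inter> V) \<union> (S \<inter> T)" using that by (auto simp: clique_def)
      then show ?thesis by (metis card_Un_le)
    qed
    ultimately show ?thesis using \<omega>[of "S \<inter> V"] by linarith
  qed
  moreover have "\<not> colorable (V \<union> T) E' (r + t)"
  proof
    assume "colorable (V \<union> T) E' (r + t)"
    then obtain P where P: "(\<Union>i<r + t. P i) = V \<union> T"
      "\<And>i j. i < r + t \<Longrightarrow> j < r + t \<Longrightarrow> i \<noteq> j \<Longrightarrow> P i \<inter> P j = {}"
      "\<And>i. i < r + t \<Longrightarrow> indep_set (V \<union> T) E' (P i)"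
      by (auto simp: colorable_def)
    have sub: "P i \<subseteq> V \<union> T" if "i < r + t" for i
      using P(3)[OF that] by (simp add: indep_set_def)
    then have finP: "finite (P i)" if "i < r + t" for i
      using that fin T(1) by (meson finite_UnI finite_subset)
    \<comment> \<open>New vertices count twice: every class then has weight at most 2, while the
      total weight is \<open>card V + 2 * t\<close>.\<close>
    have le2: "card (P i) + card (P i \<inter> T) \<le> 2" if i: "i < r + t" for i
    proof (cases "P i \<inter> T = {}")
      case True
      then have "indep_set V E (P i)"
        using P(3)[OF i] EV unfolding indep_set_def by blast
      with \<alpha> True show ?thesis by simp
    next
      case False
      then obtain x where x: "x \<in> P i" "x \<in> T" by auto
      have "y = x" if "y \<in> P i" for y
      proof (rule ccontr)
        assume "y \<noteq> x"
        then have "{x, y} \<in> E'" using E'T x that sub[OF i] by blast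
        moreover have "{x, y} \<notin> E'"
          using P(3)[OF i] x(1) that \<open>y \<noteq> x\<close> unfolding indep_set_def by metis
        ultimately show False by contradiction
      qed
      then have "P i = {x}" using x(1) by blast
      with x show ?thesis by simp
    qed
    have "card (V \<union> T) = (\<Sum>i<r + t. card (P i))"
      unfolding P(1)[symmetric] using finP P(2) by (intro card_UN_disjoint) auto
    moreover have "card T = (\<Sum>i<r + t. card (P i \<inter> T))"
    proof -
      have "T = (\<Union>i<r + t. P i \<inter> T)" using P(1) by auto
      moreover have "card (\<Union>i<r + t. P i \<inter> T) = (\<Sum>i<r + t. card (P i \<inter> T))"
        using finP P(2) by (intro card_UN_disjoint) auto
      ultimately show ?thesis by simp
    qed
    ultimately have "card (V \<union> T) + card T = (\<Sum>i<r + t. card (P i) + card (P i \<inter> T))"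
      by (simp add: sum.distrib)
    also have "\<dots> \<le> 2 * (r + t)"
      using sum_bounded_above[of "{..<r + t}" "\<lambda>i. card (P i) + card (P i \<inter> T)" 2] le2 by simp
    finally show False using card T(2) r by simp
  qed
  ultimately show ?thesis
    using F_v_leI[of "V \<union> T" E' "r + t" "q + t"] card by simp
qed

section \<open>Ramsey numbers and the Folkman bounds resting on them\<close>

lemma ramsey_number_gt:
  assumes "enat n < ramsey_number p q"
  obtains V :: "nat set" and E where "graph V E" "n \<le> card V"
    "\<And>S. clique V E S \<Longrightarrow> card S \<noteq> p" "\<And>I. indep_set V E I \<Longrightarrow> card I \<noteq> q"
proof -
  let ?A = "{n. \<forall>(V :: nat set) E. graph V E \<and> card V \<ge> n \<longrightarrow>
      (\<exists>S. clique V E S \<and> card S = p) \<or> (\<exists>I. indep_set V E I \<and> card I = q)}"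
  have "n \<notin> ?A"
  proof
    assume "n \<in> ?A"
    then have "Inf (enat ` ?A) \<le> enat n"
      by (intro Inf_lower imageI)
    with assms show False by (simp add: ramsey_number_def)
  qed
  then show thesis using that by blast
qed

lemma ramsey_number_le:
  fixes V :: "nat set"
  assumes "ramsey_number p q \<le> enat n" "graph V E" "n \<le> card V"
  shows "(\<exists>S. clique V E S \<and> card S = p) \<or> (\<exists>I. indep_set V E I \<and> card I = q)"
proof -
  let ?A = "{n. \<forall>(V :: nat set) E. graph V E \<and> card V \<ge> n \<longrightarrow>
      (\<exists>S. clique V E S \<and> card S = p) \<or> (\<exists>I. indep_set V E I \<and> card I = q)}"
  have "\<exists>k\<in>?A. k \<le> n"
  proof (rule ccontr)
    assume "\<not> ?thesis"
    then have "enat (Suc n) \<le> Inf (enat ` ?A)"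
      by (intro Inf_greatest) (force simp: not_less_eq_eq simp del: mem_Collect_eq)
    also have "\<dots> \<le> enat n"
      using assms(1) by (simp add: ramsey_number_def)
    finally show False by simp
  qed
  then obtain k where "k \<in> ?A" "k \<le> card V"
    using assms(3) le_trans by blast
  with assms(2) show ?thesis by blast
qed

text \<open>Ramsey numbers speak of exact sizes; for a hereditary property, excluding one size
  excludes all larger ones.\<close>

lemma small_subset:
  assumes "\<And>S. Q S \<Longrightarrow> card S \<noteq> Suc n" "\<And>S R. Q S \<Longrightarrow> R \<subseteq> S \<Longrightarrow> Q R" "Q S"
  shows "card S \<le> n"
proof (rule ccontr)
  assume "\<not> card S \<le> n"
  then have "Suc n \<le> card S" by simp
  then obtain R where "R \<subseteq> S" "card R = Suc n"
    by (meson obtain_subset_with_card_n)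
  with assms show False by blast
qed

lemma clique_subset: "clique V E S \<Longrightarrow> R \<subseteq> S \<Longrightarrow> clique V E R"
  by (auto simp: clique_def)

lemma indep_set_subset: "indep_set V E S \<Longrightarrow> R \<subseteq> S \<Longrightarrow> indep_set V E R"
  by (auto simp: indep_set_def)

text \<open>
  \<open>excess c\<close> bounds \<open>\<chi> - \<omega>\<close> for graphs with \<open>|V| - \<chi> \<le> c\<close>. Its jump at \<open>11\<close> makes it
  superadditive up to \<open>20\<close> and large enough for the available Ramsey bounds; \<open>excess 20 = 11\<close> is
  what part (b) needs.
\<close>

definition excess :: "nat \<Rightarrow> nat" where
  "excess c = (if c \<le> 10 then c div 2 else (c + 1) div 2 + 1)"

lemma excess_mono: "a \<le> b \<Longrightarrow> excess a \<le> excess b"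
  unfolding excess_def by presburger

lemma excess_superadd: "a + b \<le> 20 \<Longrightarrow> excess a + excess b \<le> excess (a + b)"
  unfolding excess_def by presburger

lemma excess_add_2: "excess a + 1 \<le> excess (a + 2)"
  unfolding excess_def by presburger

text \<open>Each range of \<open>a\<close> uses one bound R(3, k + 1) \<le> n with
  \<open>n \<le> 2 * a + 1\<close>, and ends before the first \<open>a\<close> that needs a larger
  \<open>k\<close>. For \<open>a = 20\<close> this would be \<open>k = 9\<close>, which is where
  R(3, 10) enters.\<close>

lemma (in triangle_free) ex_indep_set_odd:
  assumes "finite U" "card U = 2 * a + 1" "a \<le> 19"
  shows "\<exists>I. indep_set U E I \<and> a + 1 \<le> card I + excess a"
proof -
  have *: ?thesis if "(k, n) \<in> {(1, 3), (2, 6), (3, 9), (4, 14), (5, 19), (6, 24), (7, 30), (8, 37)}"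
      "n \<le> 2 * a + 1" "a \<le> k + excess a" for k n
    using ex_indep_set_gt[OF assms(1) that(1)] that(2,3) assms(2) by fastforce
  consider "a = 0" | "1 \<le> a \<and> a \<le> 2" | "3 \<le> a \<and> a \<le> 4" | "5 \<le> a \<and> a \<le> 6" | "7 \<le> a \<and> a \<le> 8"
    | "9 \<le> a \<and> a \<le> 13" | "14 \<le> a \<and> a \<le> 15" | "16 \<le> a \<and> a \<le> 17" | "18 \<le> a \<and> a \<le> 19"
    using assms(3) by linarith
  then show ?thesis
  proof cases
    case 1
    then obtain v where "U = {v}" using assms(2) by (auto simp: card_1_singleton_iff)
    with 1 show ?thesis by (intro exI[of _ "{v}"]) (auto simp: indep_set_def)
  next
    case 2
    then have "3 \<le> 2 * a + 1" "a \<le> 1 + excess a" unfolding excess_def by presburger+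
    then show ?thesis by (intro *[of 1 3]) auto
  next
    case 3
    then have "6 \<le> 2 * a + 1" "a \<le> 2 + excess a" unfolding excess_def by presburger+
    then show ?thesis by (intro *[of 2 6]) auto
  next
    case 4
    then have "9 \<le> 2 * a + 1" "a \<le> 3 + excess a" unfolding excess_def by presburger+
    then show ?thesis by (intro *[of 3 9]) auto
  next
    case 5
    then have "14 \<le> 2 * a + 1" "a \<le> 4 + excess a" unfolding excess_def by presburger+
    then show ?thesis by (intro *[of 4 14]) auto
  next
    case 6
    then have "19 \<le> 2 * a + 1" "a \<le> 5 + excess a" unfolding excess_def by presburger+
    then show ?thesis by (intro *[of 5 19]) auto
  next
    case 7
    then have "24 \<le> 2 * a + 1" "a \<le> 6 + excess a" unfolding excess_def by presburger+
    then show ?thesis by (intro *[of 6 24]) auto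
  next
    case 8
    then have "30 \<le> 2 * a + 1" "a \<le> 7 + excess a" unfolding excess_def by presburger+
    then show ?thesis by (intro *[of 7 30]) auto
  next
    case 9
    then have "37 \<le> 2 * a + 1" "a \<le> 8 + excess a" unfolding excess_def by presburger+
    then show ?thesis by (intro *[of 8 37]) auto
  qed
qed

text \<open>The clique obtained has at least \<open>r + 1 - excess c\<close> vertices. As
  \<open>excess\<close> equals 11 at both 19 and 20, \<open>c = 20\<close> gains a vertex without
  weakening the clique; the price is the case of triangle-free graphs on 41 vertices.\<close>

lemma F_v_ge:
  assumes r: "r \<ge> 13" and c: "c = 19 \<or> c = 20 \<and> ramsey_number 10 3 \<le> 41"
  shows "enat (r + 2 + c) \<le> F_v (replicate r 2) (r - 10)"
proof (rule F_v_geI)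
  fix V :: "nat set" and E
  assume V: "graph V E" "card V < r + 2 + c" "\<not> colorable V E r"
  have odd: "\<exists>I. indep_set U E I \<and> a + 1 \<le> card I + excess a"
    if "triangle_free E" "finite U" "a \<le> c" "card U = 2 * a + 1" for E :: "nat set set" and U a
  proof (cases "a \<le> 19")
    case True
    with that show ?thesis by (intro triangle_free.ex_indep_set_odd)
  next
    case False
    \<comment> \<open>The complement of \<open>U\<close> has no independent triple, so it has a
      10-clique, which suffices because \<open>21 = 10 + excess 20\<close>.\<close>
    with that(3,4) c have "card U = 41" and a: "a = 20" and R: "ramsey_number 10 3 \<le> 41" by auto
    have "graph U (complement U E)" "enat 41 = 41"
      using that(2) graph_complement by (auto simp: numeral_eq_enat)
    then consider S where "clique U (complement U E) S" "card S = 10"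
      | I where "indep_set U (complement U E) I" "card I = 3"
      using ramsey_number_le[of 10 3 41 U "complement U E"] R \<open>card U = 41\<close> by auto
    then show ?thesis
    proof cases
      case 1
      then show ?thesis
        using a by (auto simp: clique_complement excess_def)
    next
      case 2
      then obtain x y z where "I = {x, y, z}" "x \<noteq> y" "y \<noteq> z" "x \<noteq> z"
        by (metis card_3_iff)
      with 2 have "{x, y} \<in> E" "{y, z} \<in> E" "{x, z} \<in> E"
        by (auto simp: indep_set_complement clique_def)
      with triangle_free.no_triangle[OF that(1)] show ?thesis by blast
    qed
  qed
  have "\<exists>S. clique V E S \<and> r + 1 \<le> card S + excess c"
  proof (rule uncolorable_imp_clique[where F = excess and N = c and V = V and E = E and m = r and c = c])
    show "a + b \<le> c \<Longrightarrow> excess a + excess b \<le> excess (a + b)" for a b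
      using c by (intro excess_superadd) auto
  qed (use V odd excess_mono excess_add_2 in \<open>auto simp: graph_def\<close>)
  moreover have "excess c = 11" using c by (auto simp: excess_def)
  ultimately show "\<exists>S. clique V E S \<and> r - 10 \<le> card S"
    by fastforce
qed

lemma F_v_le_of_ramsey:
  assumes "ramsey_number 10 3 > 41" "r \<ge> 20"
  shows "F_v (replicate r 2) (r - 10) \<le> enat (r + 21)"
proof -
  have "enat 41 < ramsey_number 10 3"
    using assms(1) by (simp add: numeral_eq_enat)
  then obtain V :: "nat set" and E where V: "graph V E" "41 \<le> card V"
    and \<omega>: "\<And>S. clique V E S \<Longrightarrow> card S \<noteq> 10" and \<alpha>: "\<And>I. indep_set V E I \<Longrightarrow> card I \<noteq> 3"
    by (rule ramsey_number_gt) blast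
  \<comment> \<open>Exactly 41 vertices are kept: \<open>2 * 20 < 41\<close>, and joining
    \<open>r - 20\<close> further vertices gives \<open>r + 21\<close>.\<close>
  obtain W where W: "W \<subseteq> V" "card W = 41"
    using V(2) by (meson obtain_subset_with_card_n)
  define D where "D = {e \<in> E. e \<subseteq> W}"
  have clique: "clique V E S" if "clique W D S" for S
    using that W by (auto simp: clique_def D_def subset_iff)
  have indep: "indep_set V E I" if "indep_set W D I" for I
    using that W(1) by (auto simp: indep_set_def D_def subset_iff)
  have "F_v (replicate (20 + (r - 20)) 2) (10 + (r - 20)) \<le> enat (card W + (r - 20))"
  proof (rule F_v_le_join)
    show "graph W D"
      using V(1) W(1) by (auto simp: graph_def D_def intro: finite_subset)
    show "card I \<le> 2" if "indep_set W D I" for I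
    proof (rule small_subset[where Q = "indep_set W D"])
      show "card S \<noteq> Suc 2" if "indep_set W D S" for S
        using \<alpha>[OF indep[OF that]] by simp
    qed (use that indep_set_subset in blast)+
    have "card S \<le> 9" if "clique W D S" for S
    proof (rule small_subset[where Q = "clique W D"])
      show "card S \<noteq> Suc 9" if "clique W D S" for S
        using \<omega>[OF clique[OF that]] by simp
    qed (use that clique_subset in blast)+
    then show "card S < 10" if "clique W D S" for S
      using that by fastforce
  qed (use W in simp)
  then show ?thesis
    using assms(2) W(2) by (simp add: add.commute)
qed

section \<open>A circulant graph on 43 vertices\<close>

definition connection_set :: "int list" where
  "connection_set = [1, 4, 6, 9, 20, 23, 34, 37, 39, 42]"

definition circ :: "int \<Rightarrow> bool" where
  "circ d \<longleftrightarrow> d mod 43 \<in> set connection_set"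

lemma circ_uminus: "circ (- d) \<longleftrightarrow> circ d"
  by (auto simp: circ_def connection_set_def zmod_zminus1_eq_if)

text \<open>Sum-freeness makes the circulant graph triangle-free, so its complement has no
  independent triple.\<close>

lemma circ_sum_free:
  assumes "circ a" "circ b"
  shows "\<not> circ (a + b)"
proof -
  have "\<forall>x\<in>set connection_set. \<forall>y\<in>set connection_set. (x + y) mod 43 \<notin> set connection_set"
    by code_simp
  with assms have "(a mod 43 + b mod 43) mod 43 \<notin> set connection_set"
    unfolding circ_def by blast
  then show ?thesis
    by (simp add: circ_def mod_add_eq)
qed

text \<open>
  The lists partition the remaining candidates into cliques (here edges and single vertices) of the
  circulant graph, each of which contributes at most one vertex to an independent set; branches
  with fewer than \<open>k\<close> lists are cut off.
\<close>

fun no_indep :: "nat \<Rightarrow> int list list \<Rightarrow> bool" where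
  "no_indep k [] \<longleftrightarrow> 0 < k"
| "no_indep k (c # cs) \<longleftrightarrow> (if length cs + 1 < k then True else if k = 0 then False else
     (\<forall>a\<in>set c. no_indep (k - 1) (filter (\<lambda>c. c \<noteq> []) (map (filter (\<lambda>b. \<not> circ (a - b))) cs))) \<and>
     no_indep k cs)"

text \<open>Either \<open>T\<close> contains some \<open>a\<close> from the first list, and its
  other elements are non-neighbours of \<open>a\<close> in later lists, or it avoids that list. The
  cut-off is sound because \<open>T\<close> has at most one element in each list.\<close>

lemma card_less_of_no_indep:
  assumes "no_indep k cs" "T \<subseteq> (\<Union>c\<in>set cs. set c)" "\<And>a b. a \<in> T \<Longrightarrow> b \<in> T \<Longrightarrow> \<not> circ (a - b)"
    and "\<And>c a b. c \<in> set cs \<Longrightarrow> a \<in> set c \<Longrightarrow> b \<in> set c \<Longrightarrow> a \<noteq> b \<Longrightarrow> circ (a - b)"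
  shows "card T < k"
  using assms
proof (induction k cs arbitrary: T rule: no_indep.induct)
  case (2 k c cs)
  note prems = "2.prems"
  have fin: "finite T" using prems(2) by (rule finite_subset) simp
  have le1: "card (T \<inter> set d) \<le> 1" if "d \<in> set (c # cs)" for d
  proof -
    have "a = b" if "a \<in> T \<inter> set d" "b \<in> T \<inter> set d" for a b
      using prems(3,4) that \<open>d \<in> set (c # cs)\<close> by blast
    then show ?thesis using fin by (simp add: card_le_Suc0_iff_eq)
  qed
  show ?case
  proof (cases "length cs + 1 < k")
    case True
    have "T = (\<Union>d\<in>set (c # cs). T \<inter> set d)" using prems(2) by auto
    then have "card T \<le> (\<Sum>d\<in>set (c # cs). card (T \<inter> set d))"
      using card_UN_le[of "set (c # cs)" "\<lambda>d. T \<inter> set d"] by simp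
    also have "\<dots> \<le> card (set (c # cs))"
      using sum_bounded_above[of "set (c # cs)" "\<lambda>d. card (T \<inter> set d)" 1] le1 by simp
    also have "\<dots> \<le> length cs + 1" using card_length[of "c # cs"] by simp
    finally show ?thesis using True by simp
  next
    case False
    with prems(1) have k: "k \<noteq> 0" and rest: "no_indep k cs"
      and branch: "\<And>a. a \<in> set c \<Longrightarrow>
        no_indep (k - 1) (filter (\<lambda>c. c \<noteq> []) (map (filter (\<lambda>b. \<not> circ (a - b))) cs))"
      by (auto split: if_splits)
    show ?thesis
    proof (cases "T \<inter> set c = {}")
      case True
      show ?thesis
        by (rule "2.IH"(2)) (use False k rest prems True in \<open>auto; blast\<close>)+
    next
      case ne: False
      then obtain a where a: "a \<in> T" "a \<in> set c" by auto
      have "card (T - {a}) < k - 1"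
      proof (rule "2.IH"(1)[OF False k a(2) branch[OF a(2)]])
        show "T - {a} \<subseteq> (\<Union>d\<in>set (filter (\<lambda>c. c \<noteq> []) (map (filter (\<lambda>b. \<not> circ (a - b))) cs)). set d)"
        proof
          fix b assume b: "b \<in> T - {a}"
          then have "\<not> circ (a - b)" using prems(3) a by auto
          moreover have "b \<notin> set c"
            using prems(3)[of a b] prems(4)[of c a b] a b by auto
          ultimately obtain d where "d \<in> set cs" "b \<in> set (filter (\<lambda>b. \<not> circ (a - b)) d)"
            using prems(2) b by auto
          then show "b \<in> (\<Union>d\<in>set (filter (\<lambda>c. c \<noteq> []) (map (filter (\<lambda>b. \<not> circ (a - b))) cs)). set d)"
            by (auto intro!: bexI[of _ d] simp: filter_empty_conv)
        qed
        show "\<not> circ (x - y)" if "x \<in> T - {a}" "y \<in> T - {a}" for x y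
          using that prems(3) by blast
        show "circ (x - y)"
          if d: "d \<in> set (filter (\<lambda>c. c \<noteq> []) (map (filter (\<lambda>b. \<not> circ (a - b))) cs))"
            and xy: "x \<in> set d" "y \<in> set d" "x \<noteq> y" for d x y
        proof -
          obtain d' where "d' \<in> set cs" "d = filter (\<lambda>b. \<not> circ (a - b)) d'"
            using d by auto
          with xy show ?thesis
            using prems(4)[of d' x y] by simp
        qed
      qed
      then show ?thesis
        using card_Suc_Diff1[OF fin a(1)] by simp
    qed
  qed
qed simp

text \<open>
  A clique cover of the non-neighbours of \<open>0\<close>, with an order found by local search that keeps the
  search tree of \<open>no_indep\<close> near a thousand nodes.
\<close>

definition cover :: "int list list" where
  "cover = [[15, 11], [13, 12], [28, 29], [26, 30], [18, 41], [25, 16], [27, 31], [8, 17], [33, 24],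
     [40, 3], [22, 21], [2, 36], [19, 10], [7], [32, 38], [14, 5], [35]]"

lemma no_indep_cover: "no_indep 10 cover"
  by code_simp

lemma cover: "d \<in> {1..<43} \<Longrightarrow> \<not> circ d \<Longrightarrow> d \<in> (\<Union>c\<in>set cover. set c)"
  "c \<in> set cover \<Longrightarrow> a \<in> set c \<Longrightarrow> b \<in> set c \<Longrightarrow> a \<noteq> b \<Longrightarrow> circ (a - b)"
proof -
  have "\<forall>d\<in>set [1..42]. circ d \<or> d \<in> (\<Union>c\<in>set cover. set c)" by code_simp
  then show "d \<in> {1..<43} \<Longrightarrow> \<not> circ d \<Longrightarrow> d \<in> (\<Union>c\<in>set cover. set c)" by auto
  have "\<forall>c\<in>set cover. \<forall>a\<in>set c. \<forall>b\<in>set c. a = b \<or> circ (a - b)" by code_simp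
  then show "c \<in> set cover \<Longrightarrow> a \<in> set c \<Longrightarrow> b \<in> set c \<Longrightarrow> a \<noteq> b \<Longrightarrow> circ (a - b)" by blast
qed

text \<open>By translation \<open>S\<close> may be taken to contain 0; its other elements form an
  independent set of non-neighbours of 0, where \<open>no_indep_cover\<close> allows at most
  nine.\<close>

lemma card_circulant_indep:
  assumes S: "S \<subseteq> {0..<43}" and indep: "\<And>a b. a \<in> S \<Longrightarrow> b \<in> S \<Longrightarrow> \<not> circ (a - b)"
  shows "card S \<le> 10"
proof (cases "S = {}")
  case False
  then obtain s where s: "s \<in> S" by blast
  define f where "f x = (x - s) mod 43" for x
  have "inj_on f {0..<43}"
  proof (rule inj_onI)
    fix x y assume "x \<in> {0..<43}" "y \<in> {0..<43}" "f x = f y"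
    then show "x = y"
      unfolding f_def by (metis atLeastLessThan_iff diff_add_cancel mod_add_left_eq mod_pos_pos_trivial)
  qed
  then have inj: "inj_on f S" using S inj_on_subset by blast
  have circ_f: "circ (f x - f y) \<longleftrightarrow> circ (x - y)" for x y
    by (simp add: circ_def f_def mod_diff_eq)
  have fs: "f s = 0" by (simp add: f_def)
  have "card (f ` S - {0}) < 10"
  proof (rule card_less_of_no_indep[OF no_indep_cover])
    show "f ` S - {0} \<subseteq> (\<Union>c\<in>set cover. set c)"
    proof
      fix d assume d: "d \<in> f ` S - {0}"
      then obtain x where x: "x \<in> S" "d = f x" "d \<noteq> 0" by auto
      then have "d \<in> {1..<43}"
        using pos_mod_sign[of 43 "x - s"] pos_mod_bound[of 43 "x - s"] by (simp add: f_def)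
      moreover have "\<not> circ d"
        using indep[OF x(1) s] circ_f[of x s] fs x(2) by simp
      ultimately show "d \<in> (\<Union>c\<in>set cover. set c)" by (rule cover(1))
    qed
    show "\<not> circ (a - b)" if "a \<in> f ` S - {0}" "b \<in> f ` S - {0}" for a b
      using that indep circ_f by auto
  qed (rule cover(2))
  moreover have "card (f ` S) = Suc (card (f ` S - {0}))"
    using s fs S by (intro card_Suc_Diff1[symmetric]) (auto intro: finite_subset)
  ultimately show ?thesis
    using card_image[OF inj] by simp
qed simp

text \<open>The complement of the circulant graph, on natural numbers as \<open>F_v\<close>
  requires; differences are taken in the integers.\<close>

definition circ_graph :: "nat set set" where
  "circ_graph = {{x, y} |x y. x < 43 \<and> y < 43 \<and> x \<noteq> y \<and> \<not> circ (int x - int y)}"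

lemma circ_minus_commute: "circ (a - b) \<longleftrightarrow> circ (b - a)"
  using circ_uminus[of "a - b"] by simp

lemma in_circ_graph_iff:
  "{x, y} \<in> circ_graph \<longleftrightarrow> x < 43 \<and> y < 43 \<and> x \<noteq> y \<and> \<not> circ (int x - int y)"
  by (auto simp: circ_graph_def doubleton_eq_iff circ_minus_commute)

text \<open>Here \<open>2 * 21 < 43\<close>, and joining \<open>r - 21\<close> vertices gives
  \<open>r + 22\<close> vertices and no clique of size \<open>r - 10\<close>.\<close>

lemma F_v_le_circulant:
  assumes "r \<ge> 21"
  shows "F_v (replicate r 2) (r - 10) \<le> enat (r + 22)"
proof -
  have "F_v (replicate (21 + (r - 21)) 2) (11 + (r - 21)) \<le> enat (card {..<43::nat} + (r - 21))"
  proof (rule F_v_le_join)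
    show "graph {..<43} circ_graph"
      by (auto simp: graph_def circ_graph_def)
    show "card I \<le> 2" if I: "indep_set {..<43} circ_graph I" for I
    proof (rule ccontr)
      assume "\<not> card I \<le> 2"
      then have "3 \<le> card I" by simp
      then obtain J where "J \<subseteq> I" "card J = 3"
        by (meson obtain_subset_with_card_n)
      then obtain x y z where "{x, y, z} \<subseteq> I" "x \<noteq> y" "y \<noteq> z" "x \<noteq> z"
        by (metis card_3_iff)
      with I have "circ (int x - int y)" "circ (int y - int z)" "circ (int x - int z)"
        by (auto simp: indep_set_def in_circ_graph_iff)
      with circ_sum_free[of "int x - int y" "int y - int z"] show False by simp
    qed
    show "card S < 11" if S: "clique {..<43} circ_graph S" for S
    proof -
      have "\<not> circ 0" by (simp add: circ_def connection_set_def)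
      then have "\<not> circ (int x - int y)" if "x \<in> S" "y \<in> S" for x y
        using S that by (cases "x = y") (auto simp: clique_def in_circ_graph_iff)
      then have "card (int ` S) \<le> 10"
        using S by (intro card_circulant_indep) (auto simp: clique_def subset_iff)
      then show ?thesis by (simp add: card_image)
    qed
  qed simp
  then show ?thesis using assms by (simp add: add.commute)
qed

theorem theorem1p3:
  fixes r :: nat
  assumes "r \<ge> 13"
  shows "(F_v (replicate r 2) (r - 10) \<ge> enat (r + 21) \<and>
          (ramsey_number 10 3 > 41 \<and> r \<ge> 20 \<longrightarrow> F_v (replicate r 2) (r - 10) = enat (r + 21)))
       \<and> (ramsey_number 10 3 \<le> 41 \<longrightarrow>
          F_v (replicate r 2) (r - 10) \<ge> enat (r + 22) \<and>
          (r \<ge> 21 \<longrightarrow> F_v (replicate r 2) (r - 10) = enat (r + 22)))"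
proof -
  have "enat (r + 21) \<le> F_v (replicate r 2) (r - 10)"
    using F_v_ge[of r 19] assms by (simp add: add.commute)
  moreover have "enat (r + 22) \<le> F_v (replicate r 2) (r - 10)" if "ramsey_number 10 3 \<le> 41"
    using F_v_ge[of r 20] assms that by (simp add: add.commute)
  ultimately show ?thesis
    using F_v_le_of_ramsey[of r] F_v_le_circulant[of r] by (auto intro: order_antisym)
qed

end
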